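(* Let $P\subset\mathbb{R}^3$ be the set of all triples $(x_3,x_2,x_1)$ of real numbers satisfying $x_3\leq 4/9$, $x_2\leq 1/2$, $x_3+x_1\leq 2/3$, $x_3+\tfrac32 x_2\leq 1$, $x_3+x_2+x_1\leq 1$ and $x_3+\tfrac16 x_2\leq 1/2$. If $(\alpha,\beta,\gamma)\in\mathbb{R}^3$ and $(\alpha,\beta,\gamma)\notin P$ (where $x_3=\alpha$, $x_2=\beta$, $x_1=\gamma$), then for every real constant $K$ there exists a connected subcubic graph $G$ such that $\nu(G)<\alpha n_3+\beta n_2+\gamma n_1-K$.
   Context: Graphs are finite and simple; connected graphs are nonempty. A graph is subcubic if its maximum degree is at most three. For a graph $G$, $\nu(G)$ denotes the maximum size (number of edges) of a matching in $G$, and $n_i$ denotes the number of vertices of degree $i$ in $G$. *)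

theory Defs
  imports Complex_Main "Graph_Theory.Graph_Theory"
begin

text \<open>
  A finite simple graph is a \<^locale>\<open>pair_graph\<close>: a finite, loop-free, symmetric set of
  ordered pairs on a finite vertex set. An undirected edge \<open>{u, v}\<close> is represented by the two
  arcs \<open>(u, v)\<close> and \<open>(v, u)\<close>, so degrees count outgoing arcs only, and edges (hence the sizes
  of matchings) are counted as two-element sets rather than as arcs. The empty graph is a
  \<^locale>\<open>pair_graph\<close>, but it is not \<open>Digraph_Component.connected\<close>.
\<close>

definition edges :: "'a pair_pre_digraph \<Rightarrow> 'a set set" where
  "edges G = {{u, v} |u v. (u, v) \<in> parcs G}"

definition graph_degree :: "'a pair_pre_digraph \<Rightarrow> 'a \<Rightarrow> nat" where
  "graph_degree G v = out_degree (with_proj G) v"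

definition num_verts_of_degree :: "'a pair_pre_digraph \<Rightarrow> nat \<Rightarrow> nat" where
  "num_verts_of_degree G i = card {v \<in> pverts G. graph_degree G v = i}"

definition subcubic :: "'a pair_pre_digraph \<Rightarrow> bool" where
  "subcubic G \<longleftrightarrow> (\<forall>v \<in> pverts G. graph_degree G v \<le> 3)"

definition connected_graph :: "'a pair_pre_digraph \<Rightarrow> bool" where
  "connected_graph G \<longleftrightarrow> Digraph_Component.connected (with_proj G)"

definition matching :: "'a pair_pre_digraph \<Rightarrow> 'a set set \<Rightarrow> bool" where
  "matching G M \<longleftrightarrow> M \<subseteq> edges G \<and> (\<forall>e \<in> M. \<forall>f \<in> M. e \<noteq> f \<longrightarrow> e \<inter> f = {})"

definition matching_number :: "'a pair_pre_digraph \<Rightarrow> nat" where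
  "matching_number G = Max (card ` {M. matching G M})"

lemma (in pair_graph) finite_matchings: "finite {M. matching G M}"
proof -
  have "edges G = (\<lambda>(u, v). {u, v}) ` parcs G"
    by (auto simp: edges_def)
  then have "finite (edges G)"
    using pair_finite_arcs by simp
  then show ?thesis
    by (rule finite_subset[rotated, OF finite_Pow_iff[THEN iffD2]]) (auto simp: matching_def)
qed

lemma matching_empty: "matching G {}"
  by (simp add: matching_def)

text \<open>Triples are ordered as \<open>(x\<^sub>3, x\<^sub>2, x\<^sub>1)\<close>.\<close>

definition P :: "(real \<times> real \<times> real) set" where
  "P = {(x3, x2, x1).
      x3 \<le> 4 / 9 \<and>
      x2 \<le> 1 / 2 \<and>
      x3 + x1 \<le> 2 / 3 \<and>
      x3 + 3 / 2 * x2 \<le> 1 \<and>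
      x3 + x2 + x1 \<le> 1 \<and>
      x3 + 1 / 6 * x2 \<le> 1 / 2}"

end

theory Submission
  imports Defs
begin

text \<open>
  Each of the six inequalities defining \<^const>\<open>P\<close> is forced, even up to an additive constant, by a
  family of graphs obtained by repeating one finite cell \<open>k\<close> times around a ring, consecutive
  cells being joined by a single edge. If a cell has \<open>m\<^sub>d\<close> vertices of degree \<open>d\<close>, the ring has
  exactly \<open>k m\<^sub>d\<close> of them. Its matching number is bounded by the easy half of the Tutte--Berge
  formula (\<open>matching_number_le\<close>): if every edge meets a vertex set \<open>S\<close> or lies inside one of some
  sets \<open>X\<^sub>i\<close>, then a matching has at most \<open>|S| + \<Sum>\<^sub>i \<lfloor>|X\<^sub>i| / 2\<rfloor>\<close> edges. When \<open>S\<close> and the \<open>X\<^sub>i\<close> are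
  repeated with the cell, this reads \<open>\<nu> \<le> k c\<close> for a constant \<open>c\<close> of the cell. Hence if
  \<open>c < \<alpha> m\<^sub>3 + \<beta> m\<^sub>2 + \<gamma> m\<^sub>1\<close>, then taking \<open>k\<close> large makes
  \<open>\<alpha> n\<^sub>3 + \<beta> n\<^sub>2 + \<gamma> n\<^sub>1 - \<nu>\<close> exceed any given \<open>K\<close> (\<open>ring_family\<close>).

  It remains to give six cells. The sets \<open>X\<^sub>i\<close> are copies of a gadget on five vertices (\<open>K\<^sub>4\<close> with
  one edge subdivided, the subdividing vertex being attached to the rest of the graph). The values
  of \<open>(m\<^sub>3, m\<^sub>2, m\<^sub>1; c)\<close> are
    \<^item> \<open>(18, 0, 0; 8)\<close> for \<open>x\<^sub>3 \<le> 4/9\<close>,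
    \<^item> \<open>(0, 2, 0; 1)\<close> for \<open>x\<^sub>2 \<le> 1/2\<close>,
    \<^item> \<open>(3, 0, 3; 2)\<close> for \<open>x\<^sub>3 + x\<^sub>1 \<le> 2/3\<close>,
    \<^item> \<open>(2, 3, 0; 2)\<close> for \<open>x\<^sub>3 + 3/2 x\<^sub>2 \<le> 1\<close>,
    \<^item> \<open>(1, 1, 1; 1)\<close> for \<open>x\<^sub>3 + x\<^sub>2 + x\<^sub>1 \<le> 1\<close>,
    \<^item> \<open>(6, 1, 0; 3)\<close> for \<open>x\<^sub>3 + 1/6 x\<^sub>2 \<le> 1/2\<close>.

  The first cell arises from the third, and the last from the fifth, by replacing every leaf with
  a gadget.
\<close>

section \<open>An upper bound on the matching number\<close>

lemma card_disjoint_pairs_le: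
  assumes "finite X" "\<And>e. e \<in> M \<Longrightarrow> e \<subseteq> X \<and> card e = 2"
    and "\<And>e f. e \<in> M \<Longrightarrow> f \<in> M \<Longrightarrow> e \<noteq> f \<Longrightarrow> e \<inter> f = {}"
  shows "card M \<le> card X div 2"
proof -
  have fin: "finite e" if "e \<in> M" for e
    using assms(1,2) that finite_subset by blast
  have "card (\<Union>M) = (\<Sum>e\<in>M. card e)"
    by (rule card_Union_disjoint) (use assms(3) fin in \<open>auto simp: pairwise_def disjnt_def\<close>)
  also have "\<dots> = 2 * card M"
    using assms(2) by simp
  finally have "2 * card M = card (\<Union>M)" by simp
  also have "\<dots> \<le> card X"
    by (rule card_mono) (use assms(1,2) in auto)
  finally show ?thesis by simp
qed

lemma card_disjoint_hitting_le:
  assumes "finite S" "\<And>e. e \<in> M \<Longrightarrow> e \<inter> S \<noteq> {}"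
    and "\<And>e f. e \<in> M \<Longrightarrow> f \<in> M \<Longrightarrow> e \<noteq> f \<Longrightarrow> e \<inter> f = {}"
  shows "card M \<le> card S"
proof -
  have "\<forall>e\<in>M. \<exists>v. v \<in> e \<inter> S" using assms(2) by blast
  then obtain g where g: "\<forall>e\<in>M. g e \<in> e \<inter> S" by metis
  have "inj_on g M"
  proof (rule inj_onI, rule ccontr)
    fix e f assume ef: "e \<in> M" "f \<in> M" "g e = g f" "e \<noteq> f"
    have "g e \<in> e" "g f \<in> f" using g ef by blast+
    then have "g e \<in> e \<inter> f" using ef(3) by simp
    moreover have "e \<inter> f = {}" using assms(3) ef by blast
    ultimately show False by simp
  qed
  moreover have "g ` M \<subseteq> S" using g by auto
  ultimately show ?thesis using card_inj_on_le assms(1) by blast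
qed

text \<open>
  The easy half of the Tutte--Berge formula: at most \<open>|S|\<close> edges of a matching meet \<open>S\<close>, and at most
  \<open>|X i| div 2\<close> lie inside \<open>X i\<close>. The sets \<open>X i\<close> need not be disjoint.
\<close>

lemma (in pair_graph) matching_number_le:
  assumes "finite S" "finite I" and finite_X: "\<And>i. i \<in> I \<Longrightarrow> finite (X i)"
    and cover: "\<And>x y. (x, y) \<in> parcs G \<Longrightarrow> x \<in> S \<or> y \<in> S \<or> (\<exists>i\<in>I. x \<in> X i \<and> y \<in> X i)"
  shows "matching_number G \<le> card S + (\<Sum>i\<in>I. card (X i) div 2)"
proof -
  have bound: "card M \<le> card S + (\<Sum>i\<in>I. card (X i) div 2)" if M: "matching G M" for M
  proof -
    let ?hit = "{e \<in> M. e \<inter> S \<noteq> {}}" and ?sub = "\<lambda>i. {e \<in> M. e \<subseteq> X i}"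
    have disj: "e \<inter> f = {}" if "e \<in> M" "f \<in> M" "e \<noteq> f" for e f
      using M that by (auto simp: matching_def)
    have two: "card e = 2" if e: "e \<in> M" for e
    proof -
      obtain x y where "e = {x, y}" "(x, y) \<in> parcs G"
        using M e by (auto simp: matching_def edges_def)
      then show ?thesis using pair_no_loops[of "(x, y)"] by auto
    qed
    have "edges G = (\<lambda>(u, v). {u, v}) ` parcs G"
      by (auto simp: edges_def)
    then have "finite M"
      using M pair_finite_arcs by (auto simp: matching_def intro: finite_subset)
    have "M \<subseteq> ?hit \<union> (\<Union>i\<in>I. ?sub i)"
    proof
      fix e assume e: "e \<in> M"
      then obtain x y where "e = {x, y}" "(x, y) \<in> parcs G"
        using M by (auto simp: matching_def edges_def)
      then show "e \<in> ?hit \<union> (\<Union>i\<in>I. ?sub i)"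
        using cover[of x y] e by auto
    qed
    then have "card M \<le> card (?hit \<union> (\<Union>i\<in>I. ?sub i))"
      using \<open>finite M\<close> \<open>finite I\<close> by (intro card_mono) auto
    also have "\<dots> \<le> card ?hit + card (\<Union>i\<in>I. ?sub i)"
      by (rule card_Un_le)
    also have "\<dots> \<le> card S + (\<Sum>i\<in>I. card (X i) div 2)"
    proof (rule add_mono)
      show "card ?hit \<le> card S"
        by (rule card_disjoint_hitting_le) (use assms(1) disj in auto)
      have "card (\<Union>i\<in>I. ?sub i) \<le> (\<Sum>i\<in>I. card (?sub i))"
        by (rule card_UN_le) fact
      also have "\<dots> \<le> (\<Sum>i\<in>I. card (X i) div 2)"
        by (intro sum_mono card_disjoint_pairs_le finite_X) (use disj two in auto)
      finally show "card (\<Union>i\<in>I. ?sub i) \<le> (\<Sum>i\<in>I. card (X i) div 2)" .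
    qed
    finally show ?thesis .
  qed
  show ?thesis
    unfolding matching_number_def
    by (subst Max_le_iff) (use finite_matchings matching_empty bound in auto)
qed

section \<open>Rings of cells\<close>

text \<open>
  A cell is a graph on the vertices \<open>0, \<dots>, p - 1\<close> with edges \<open>E\<close>, each listed in one direction
  only. The vertex \<open>a\<close> of the \<open>i\<close>-th of \<open>k\<close> copies of the cell is encoded as \<open>i * p + a\<close>, so that a
  vertex \<open>x\<close> belongs to copy \<open>x div p\<close>, at position \<open>x mod p\<close>. Besides the edges inside the copies,
  there is an edge from position \<open>u\<close> of each copy to position \<open>0\<close> of the cyclically next one.
\<close>

definition ring_edge :: "nat \<Rightarrow> nat \<Rightarrow> nat \<Rightarrow> (nat \<times> nat) set \<Rightarrow> nat \<Rightarrow> nat \<Rightarrow> bool" where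
  "ring_edge k p u E x y \<longleftrightarrow>
     x div p = y div p \<and> (x mod p, y mod p) \<in> E \<or>
     x mod p = u \<and> y mod p = 0 \<and> y div p = Suc (x div p) mod k"

text \<open>The symmetric closure of \<^const>\<open>ring_edge\<close> on the vertices of \<open>k\<close> copies.\<close>

definition ring_graph :: "nat \<Rightarrow> nat \<Rightarrow> nat \<Rightarrow> (nat \<times> nat) set \<Rightarrow> nat pair_pre_digraph" where
  "ring_graph k p u E = \<lparr>pverts = {..<k * p},
     parcs = {(x, y). x < k * p \<and> y < k * p \<and> (ring_edge k p u E x y \<or> ring_edge k p u E y x)}\<rparr>"

text \<open>
  The degree of position \<open>a\<close> in the ring: its degree inside the cell, plus one for the edge joining
  two copies if \<open>a\<close> is one of the two positions \<open>0\<close> and \<open>u\<close> (which are distinct below).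
\<close>

definition cell_degree :: "nat \<Rightarrow> (nat \<times> nat) set \<Rightarrow> nat \<Rightarrow> nat" where
  "cell_degree u E a = card ((E \<union> E\<inverse>) `` {a}) + (if a = 0 \<or> a = u then 1 else 0)"

lemma div_mod_encode:
  assumes "a < (p::nat)"
  shows "(i * p + a) div p = i" "(i * p + a) mod p = a"
  using assms by auto

lemma encode_less:
  assumes "i < (k::nat)" "a < p"
  shows "i * p + a < k * p"
proof -
  have "i * p + a < Suc i * p" using assms by simp
  also have "\<dots> \<le> k * p" using assms by (intro mult_right_mono) auto
  finally show ?thesis .
qed

lemma card_periodic:
  assumes "0 < p"
  shows "card {x. x < k * p \<and> Q (x mod p)} = k * card {a. a < p \<and> Q a}"
proof -
  let ?f = "\<lambda>(i, a). i * p + a"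
  have "{x. x < k * p \<and> Q (x mod p)} = ?f ` ({..<k} \<times> {a. a < p \<and> Q a})" (is "?L = ?R")
  proof
    show "?L \<subseteq> ?R"
    proof
      fix x assume "x \<in> ?L"
      then have "(x div p, x mod p) \<in> {..<k} \<times> {a. a < p \<and> Q a}" "x = ?f (x div p, x mod p)"
        using assms by (auto simp: less_mult_imp_div_less)
      then show "x \<in> ?R" by blast
    qed
    show "?R \<subseteq> ?L"
      using assms by (auto simp: encode_less)
  qed
  moreover have "inj_on ?f ({..<k} \<times> {a. a < p \<and> Q a})"
    by (rule inj_onI) (auto, (metis div_mod_encode)+)
  ultimately show ?thesis
    by (simp add: card_image card_cartesian_product)
qed

text \<open>
  The assumption \<open>parent\<close> gives every position except \<open>0\<close> a neighbour at a smaller position, which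
  makes the cell connected. With \<open>k \<ge> 2\<close> and \<open>u \<noteq> 0\<close>, the joining edges are neither loops nor
  parallel to other edges.
\<close>

locale ring_of_cells =
  fixes k p u :: nat and E :: "(nat \<times> nat) set"
  assumes k: "2 \<le> k"
    and u: "0 < u" "u < p"
    and edge: "\<And>a b. (a, b) \<in> E \<Longrightarrow> a < b \<and> b < p"
    and parent: "\<And>b. 0 < b \<Longrightarrow> b < p \<Longrightarrow> \<exists>a. (a, b) \<in> E"
begin

abbreviation "R \<equiv> ring_graph k p u E"

lemma p: "0 < p" using u by simp

lemma succ_neq: "i < k \<Longrightarrow> Suc i mod k \<noteq> i"
  using k by (auto simp: mod_Suc)

lemma pverts_R: "pverts R = {..<k * p}"
  by (simp add: ring_graph_def)

lemma parcs_R: "(x, y) \<in> parcs R \<longleftrightarrow>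
    x < k * p \<and> y < k * p \<and> (ring_edge k p u E x y \<or> ring_edge k p u E y x)"
  by (simp add: ring_graph_def)

lemma div_less: "x < k * p \<Longrightarrow> x div p < k"
  by (simp add: less_mult_imp_div_less)

lemma pair_graph_R: "pair_graph R"
proof
  show "finite (pverts R)" by (simp add: pverts_R)
  have "parcs R \<subseteq> pverts R \<times> pverts R" by (auto simp: parcs_R pverts_R)
  then show "finite (parcs R)"
    by (rule finite_subset) (simp add: pverts_R)
  show "symmetric R"
    by (auto simp: symmetric_def sym_def parcs_R)
  fix e assume "e \<in> parcs R"
  then obtain x y where e: "e = (x, y)" "(x, y) \<in> parcs R" by (cases e) auto
  then show "fst e \<in> pverts R" "snd e \<in> pverts R"
    by (auto simp: parcs_R pverts_R)
  show "fst e \<noteq> snd e"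
    using e u edge succ_neq[OF div_less] by (auto simp: parcs_R ring_edge_def)
qed

text \<open>
  Following smaller neighbours leads every vertex to \<open>0\<close>; position \<open>0\<close> of a copy other than the first
  is joined to the preceding copy.
\<close>

lemma ex_smaller_neighbour:
  assumes "0 < x" "x < k * p"
  shows "\<exists>y<x. (x, y) \<in> parcs R"
proof (cases "x mod p = 0")
  case True
  then have x: "x = x div p * p" by auto
  then have i: "0 < x div p" "x div p < k"
    using assms div_less by (metis gr0I mult_0, blast)
  define y where "y = (x div p - 1) * p + u"
  have "y div p = x div p - 1" "y mod p = u"
    unfolding y_def using u by (simp_all add: div_mod_encode)
  moreover have "y < x"
    using encode_less[of "x div p - 1" "x div p" u p] i u x by (simp add: y_def)
  ultimately have "y < x \<and> (x, y) \<in> parcs R"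
    using assms i True by (auto simp: parcs_R ring_edge_def)
  then show ?thesis by blast
next
  case False
  then obtain a where a: "(a, x mod p) \<in> E"
    using parent[of "x mod p"] p by auto
  define y where "y = x div p * p + a"
  have lt: "a < x mod p" using a edge by blast
  then have "a < p" by (meson less_trans mod_less_divisor p)
  then have "y div p = x div p" "y mod p = a"
    unfolding y_def by (simp_all add: div_mod_encode)
  moreover have "y < x"
    using lt div_mult_mod_eq[of x p] unfolding y_def by linarith
  ultimately have "y < x \<and> (x, y) \<in> parcs R"
    using assms a by (auto simp: parcs_R ring_edge_def)
  then show ?thesis by blast
qed

lemma connected_R: "connected_graph R"
proof -
  interpret pair_graph R by (rule pair_graph_R)
  have reach0: "x \<rightarrow>\<^sup>*\<^bsub>with_proj R\<^esub> 0" if "x < k * p" for x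
    using that
  proof (induction x rule: less_induct)
    case (less x)
    show ?case
    proof (cases "x = 0")
      case True
      then show ?thesis using less by (simp add: pverts_R)
    next
      case False
      then obtain y where y: "y < x" "(x, y) \<in> parcs R"
        using ex_smaller_neighbour less.prems by auto
      then have "y \<rightarrow>\<^sup>*\<^bsub>with_proj R\<^esub> 0" using less by simp
      with y show ?thesis
        by (meson adj_reachable_trans)
    qed
  qed
  show ?thesis
    unfolding connected_graph_def
  proof (rule connectedI)
    show "pverts R \<noteq> {}"
      using k p by (auto simp: pverts_R lessThan_empty_iff)
    fix x y assume "x \<in> pverts R" "y \<in> pverts R"
    then have "x \<rightarrow>\<^sup>*\<^bsub>with_proj R\<^esub> 0" "0 \<rightarrow>\<^sup>*\<^bsub>with_proj R\<^esub> y"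
      using reach0 symmetric_reachable' by (auto simp: pverts_R)
    then show "x \<rightarrow>\<^sup>*\<^bsub>with_proj (mk_symmetric (with_proj R))\<^esub> y"
      by (meson reachable_mk_symmetricI reachable_trans)
  qed
qed

text \<open>
  The neighbours of a vertex are those inside its copy, and at positions \<open>u\<close> and \<open>0\<close> one more vertex
  in the next and the previous copy, respectively. As \<open>k \<ge> 2\<close>, these lie outside the copy. If
  \<open>k = 2\<close>, the next and previous copies coincide, but \<open>u \<noteq> 0\<close> ensures that each vertex has at most
  one such extra neighbour.
\<close>

lemma degree_R:
  assumes x: "x < k * p"
  shows "graph_degree R x = cell_degree u E (x mod p)"
proof -
  define i a where "i = x div p" and "a = x mod p"
  define pred where "pred = (if i = 0 then k - 1 else i - 1)"
  define N where "N = (E \<union> E\<inverse>) `` {a}"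
  have ia: "i < k" "a < p" using div_less[OF x] p by (simp_all add: i_def a_def)
  have pred: "pred < k" "pred \<noteq> i" using k ia by (auto simp: pred_def)
  have pred_iff: "i = Suc j mod k \<longleftrightarrow> j = pred" if "j < k" for j
    using that ia k by (auto simp: pred_def mod_Suc)
  have N_less: "b < p" if "b \<in> N" for b
    using that edge by (fastforce simp: N_def)
  have finN: "finite N"
    by (rule finite_subset[of _ "{..<p}"]) (use N_less in auto)
  let ?A = "(\<lambda>b. i * p + b) ` N"
  let ?next = "if a = u then {Suc i mod k * p} else {}"
  let ?prev = "if a = 0 then {pred * p + u} else {}"
  have nbrs: "{y. (x, y) \<in> parcs R} = ?A \<union> (?next \<union> ?prev)" (is "?L = ?R")
  proof
    show "?L \<subseteq> ?R"
    proof
      fix y assume y: "y \<in> ?L"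
      have yeq: "y = y div p * p + y mod p" by simp
      have yk: "y div p < k" using y div_less by (auto simp: parcs_R)
      consider "y div p = i" "y mod p \<in> N" | "a = u" "y mod p = 0" "y div p = Suc i mod k"
        | "a = 0" "y mod p = u" "i = Suc (y div p) mod k"
        using y by (auto simp: parcs_R ring_edge_def i_def a_def N_def)
      then show "y \<in> ?R"
      proof cases
        case 1
        then show ?thesis using yeq by blast
      next
        case 2
        then show ?thesis using yeq by auto
      next
        case 3
        then show ?thesis using yeq pred_iff[OF yk] by auto
      qed
    qed
    show "?R \<subseteq> ?L"
    proof
      fix y assume "y \<in> ?R"
      then consider b where "b \<in> N" "y = i * p + b" | "a = u" "y = Suc i mod k * p + 0"
        | "a = 0" "y = pred * p + u"
        by (auto split: if_splits)
      then show "y \<in> ?L"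
      proof cases
        case (1 b)
        then show ?thesis
          using N_less[of b] ia x
          by (auto simp: parcs_R ring_edge_def div_mod_encode encode_less i_def[symmetric]
              a_def[symmetric] N_def)
      next
        case 2
        have "y div p = Suc i mod k" "y mod p = 0" "y < k * p"
          unfolding 2 using p k by (simp_all only: div_mod_encode encode_less mod_less_divisor)
        then show ?thesis
          using 2 x by (auto simp: parcs_R ring_edge_def i_def[symmetric] a_def[symmetric])
      next
        case 3
        have "y div p = pred" "y mod p = u" "y < k * p"
          unfolding 3 using u pred by (simp_all only: div_mod_encode encode_less)
        then show ?thesis
          using 3 x pred_iff[OF pred(1)]
          by (auto simp: parcs_R ring_edge_def i_def[symmetric] a_def[symmetric])
      qed
    qed
  qed
  have div_A: "y div p = i" if "y \<in> ?A" for y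
    using that N_less by (auto simp: div_mod_encode)
  have "Suc i mod k * p \<notin> ?A"
    using div_A[of "Suc i mod k * p"] succ_neq[OF ia(1)] p by auto
  moreover have "pred * p + u \<notin> ?A"
    using div_A[of "pred * p + u"] pred(2) div_mod_encode(1)[OF u(2)] by auto
  ultimately have disj: "?A \<inter> (?next \<union> ?prev) = {}" by auto
  have "out_arcs (with_proj R) x = Pair x ` {y. (x, y) \<in> parcs R}"
    by (auto simp: out_arcs_def)
  then have "graph_degree R x = card {y. (x, y) \<in> parcs R}"
    by (simp add: graph_degree_def out_degree_def card_image inj_on_def)
  also have "\<dots> = card ?A + card (?next \<union> ?prev)"
    unfolding nbrs by (rule card_Un_disjoint) (use finN disj in auto)
  also have "card ?A = card N"
    by (simp add: card_image inj_on_def)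
  also have "card (?next \<union> ?prev) = (if a = 0 \<or> a = u then 1 else 0)"
    using u by auto
  finally show ?thesis by (simp add: cell_degree_def N_def a_def)
qed

lemma num_verts_R: "num_verts_of_degree R d = k * card {a. a < p \<and> cell_degree u E a = d}"
proof -
  have "{x \<in> pverts R. graph_degree R x = d} = {x. x < k * p \<and> cell_degree u E (x mod p) = d}"
    using degree_R by (auto simp: pverts_R)
  then show ?thesis
    unfolding num_verts_of_degree_def
    using card_periodic[OF p, where Q = "\<lambda>a. cell_degree u E a = d"] by simp
qed

lemma subcubic_R: "(\<And>a. a < p \<Longrightarrow> cell_degree u E a \<le> 3) \<Longrightarrow> subcubic R"
  by (simp add: subcubic_def pverts_R degree_R p)

text \<open>
  The bound \<open>matching_number_le\<close> for the cover consisting of all copies of \<open>S\<close> and of the sets \<open>X c\<close>;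
  since \<open>0 \<in> S\<close>, it takes care of the edges between copies.
\<close>

lemma matching_number_R:
  assumes S: "0 \<in> S" "S \<subseteq> {..<p}" and "finite C" and X: "\<And>c. c \<in> C \<Longrightarrow> finite (X c)"
    and cover: "\<And>a b. (a, b) \<in> E \<Longrightarrow> a \<in> S \<or> b \<in> S \<or> (\<exists>c\<in>C. a \<in> X c \<and> b \<in> X c)"
  shows "matching_number R \<le> k * (card S + (\<Sum>c\<in>C. card (X c) div 2))"
proof -
  interpret pair_graph R by (rule pair_graph_R)
  let ?S = "{x. x < k * p \<and> x mod p \<in> S}"
  let ?X = "\<lambda>(i, c). (\<lambda>b. i * p + b) ` X c"
  have "matching_number R \<le> card ?S + (\<Sum>j\<in>{..<k} \<times> C. card (?X j) div 2)"
  proof (rule matching_number_le)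
    show "finite ({..<k} \<times> C)" using \<open>finite C\<close> by simp
    show "finite (?X j)" if "j \<in> {..<k} \<times> C" for j
      using that X by auto
    have *: "x \<in> ?S \<or> y \<in> ?S \<or> (\<exists>j\<in>{..<k} \<times> C. x \<in> ?X j \<and> y \<in> ?X j)"
      if "x < k * p" "y < k * p" "ring_edge k p u E x y" for x y
    proof (cases "y mod p \<in> S \<or> x mod p \<in> S")
      case True
      then show ?thesis using that by auto
    next
      case False
      then have E: "x div p = y div p" "(x mod p, y mod p) \<in> E"
        using that(3) S(1) by (auto simp: ring_edge_def)
      then obtain c where "c \<in> C" "x mod p \<in> X c" "y mod p \<in> X c"
        using cover False by blast
      moreover have "x = x div p * p + x mod p" "y = x div p * p + y mod p"
        by (simp, metis E(1) div_mult_mod_eq)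
      ultimately have "(x div p, c) \<in> {..<k} \<times> C" "x \<in> ?X (x div p, c)" "y \<in> ?X (x div p, c)"
        using div_less[OF that(1)] by blast+
      then show ?thesis by blast
    qed
    show "x \<in> ?S \<or> y \<in> ?S \<or> (\<exists>j\<in>{..<k} \<times> C. x \<in> ?X j \<and> y \<in> ?X j)"
      if "(x, y) \<in> parcs R" for x y
      using that *[of x y] *[of y x] unfolding parcs_R by blast
  qed simp
  also have "card ?S = k * card {a. a < p \<and> a \<in> S}"
    by (rule card_periodic[OF p])
  also have "{a. a < p \<and> a \<in> S} = S" using S by auto
  also have "(\<Sum>j\<in>{..<k} \<times> C. card (?X j) div 2) = (\<Sum>(i, c)\<in>{..<k} \<times> C. card (X c) div 2)"
    by (rule sum.cong) (auto simp: card_image inj_on_def)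
  also have "\<dots> = k * (\<Sum>c\<in>C. card (X c) div 2)"
    by (simp add: sum.cartesian_product [symmetric])
  finally show ?thesis by (simp add: distrib_left)
qed

end

section \<open>Cells that violate a linear bound\<close>

lemma count_list_map_eq: "count_list (map f xs) d = length (filter (\<lambda>a. f a = d) xs)"
  by (induction xs) auto

text \<open>
  The list \<open>ds\<close> gives the degrees of the positions \<open>0, \<dots>, p - 1\<close>, and \<open>C\<close> the first positions of
  the gadgets, which occupy five consecutive positions each and contribute \<open>5 div 2 = 2\<close> to the
  matching bound. All hypotheses except \<open>gap\<close> are decidable statements about explicit finite sets.
\<close>

lemma ring_family:
  fixes \<alpha> \<beta> \<gamma> K :: real
  assumes u: "0 < u" "u < p"
    and edge: "\<forall>(a, b)\<in>E. a < b \<and> b < p"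
    and parent: "{1..<p} \<subseteq> snd ` E"
    and degrees: "map (cell_degree u E) [0..<p] = ds" "\<forall>d\<in>set ds. d \<le> 3"
    and S: "0 \<in> S" "S \<subseteq> {..<p}" and C: "finite C"
    and cover: "\<forall>(a, b)\<in>E. a \<in> S \<or> b \<in> S \<or> (\<exists>c\<in>C. a \<in> {c..<c + 5} \<and> b \<in> {c..<c + 5})"
    and gap: "real (card S + 2 * card C) <
      \<alpha> * real (count_list ds 3) + \<beta> * real (count_list ds 2) + \<gamma> * real (count_list ds 1)"
  shows "\<exists>G :: nat pair_pre_digraph.
    pair_graph G \<and> connected_graph G \<and> subcubic G \<and>
    real (matching_number G) <
      \<alpha> * real (num_verts_of_degree G 3) + \<beta> * real (num_verts_of_degree G 2)
        + \<gamma> * real (num_verts_of_degree G 1) - K"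
proof -
  define c where "c = card S + 2 * card C"
  define w where "w = \<alpha> * real (count_list ds 3) + \<beta> * real (count_list ds 2)
    + \<gamma> * real (count_list ds 1)"
  have "0 < w - real c" using gap by (simp add: c_def w_def)
  then obtain k0 :: nat where k0: "K < real k0 * (w - real c)"
    using reals_Archimedean3 by metis
  define k where "k = max 2 k0"
  have "real k0 * (w - real c) \<le> real k * (w - real c)"
    using \<open>0 < w - real c\<close> by (intro mult_right_mono) (auto simp: k_def)
  then have gain: "K < real k * (w - real c)" using k0 by simp
  interpret ring_of_cells k p u E
  proof
    show "\<exists>a. (a, b) \<in> E" if "0 < b" "b < p" for b
    proof -
      have "b \<in> snd ` E" using that parent by auto
      then show ?thesis by force
    qed
  qed (use u edge in \<open>auto simp: k_def\<close>)
  have count: "card {a. a < p \<and> cell_degree u E a = d} = count_list ds d" for d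
  proof -
    have "count_list ds d = length (filter (\<lambda>a. cell_degree u E a = d) [0..<p])"
      unfolding degrees(1)[symmetric] by (simp add: count_list_map_eq)
    also have "\<dots> = card (set (filter (\<lambda>a. cell_degree u E a = d) [0..<p]))"
      by (simp only: distinct_card distinct_filter distinct_upt)
    also have "set (filter (\<lambda>a. cell_degree u E a = d) [0..<p]) = {a. a < p \<and> cell_degree u E a = d}"
      by auto
    finally show ?thesis by simp
  qed
  have "matching_number R \<le> k * (card S + (\<Sum>c\<in>C. card {c..<c + 5} div 2))"
    by (rule matching_number_R) (use S C cover in auto)
  then have "matching_number R \<le> k * c"
    by (simp add: c_def mult.commute)
  then have "real (matching_number R) \<le> real k * real c"
    by (metis of_nat_le_iff of_nat_mult)
  also have "\<dots> < real k * w - K"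
    using gain by (simp add: algebra_simps)
  also have "real k * w = \<alpha> * real (num_verts_of_degree R 3) + \<beta> * real (num_verts_of_degree R 2)
        + \<gamma> * real (num_verts_of_degree R 1)"
    unfolding num_verts_R count w_def by (simp add: algebra_simps)
  finally have "real (matching_number R) < \<alpha> * real (num_verts_of_degree R 3)
      + \<beta> * real (num_verts_of_degree R 2) + \<gamma> * real (num_verts_of_degree R 1) - K" .
  moreover have "subcubic R"
    by (rule subcubic_R) (use degrees in auto)
  ultimately show ?thesis using pair_graph_R connected_R by blast
qed

text \<open>
  Attached to the vertex \<open>t\<close>, the gadget on \<open>c, \<dots>, c + 4\<close>: the complete graph on
  \<open>c + 1, \<dots>, c + 4\<close> whose edge between \<open>c + 1\<close> and \<open>c + 2\<close> is subdivided by \<open>c\<close>, together with the edge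
  from \<open>t\<close> to \<open>c\<close>. All five vertices have degree three.
\<close>

definition gadget :: "nat \<Rightarrow> nat \<Rightarrow> (nat \<times> nat) set" where
  "gadget t c = {(t, c), (c, c + 1), (c, c + 2), (c + 1, c + 3), (c + 1, c + 4),
     (c + 2, c + 3), (c + 2, c + 4), (c + 3, c + 4)}"

theorem theorem5:
  fixes \<alpha> \<beta> \<gamma> :: real
  assumes "(\<alpha>, \<beta>, \<gamma>) \<notin> P"
  shows "\<forall>K :: real. \<exists>G :: nat pair_pre_digraph.
    pair_graph G \<and> connected_graph G \<and> subcubic G \<and>
    real (matching_number G) <
      \<alpha> * real (num_verts_of_degree G 3) + \<beta> * real (num_verts_of_degree G 2)
        + \<gamma> * real (num_verts_of_degree G 1) - K"
proof
  fix K :: real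
  consider "4 / 9 < \<alpha>" | "1 / 2 < \<beta>" | "2 / 3 < \<alpha> + \<gamma>" | "1 < \<alpha> + 3 / 2 * \<beta>"
    | "1 < \<alpha> + \<beta> + \<gamma>" | "1 / 2 < \<alpha> + 1 / 6 * \<beta>"
    using assms by (auto simp: P_def not_le)
  then show "\<exists>G :: nat pair_pre_digraph.
    pair_graph G \<and> connected_graph G \<and> subcubic G \<and>
    real (matching_number G) <
      \<alpha> * real (num_verts_of_degree G 3) + \<beta> * real (num_verts_of_degree G 2)
        + \<gamma> * real (num_verts_of_degree G 1) - K"
  proof cases
    case 1
    \<comment> \<open>The cell used for \<open>2 / 3 < \<alpha> + \<gamma>\<close>, its leaves \<open>3\<close>, \<open>4\<close> and \<open>5\<close> replaced with gadgets.\<close>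
    show ?thesis
    proof (rule ring_family)
      let ?E = "{(0, 1), (1, 2)} \<union> gadget 0 3 \<union> gadget 2 8 \<union> gadget 2 13 :: (nat \<times> nat) set"
      let ?S = "{0, 2} :: nat set" and ?C = "{3, 8, 13} :: nat set" and ?ds = "replicate 18 3 :: nat list"
      show "map (cell_degree 1 ?E) [0..<18] = ?ds"
        by code_simp
      show "\<forall>(a, b)\<in>?E. a < b \<and> b < 18" "{1..<18} \<subseteq> snd ` ?E"
        "\<forall>(a, b)\<in>?E. a \<in> ?S \<or> b \<in> ?S \<or> (\<exists>c\<in>?C. a \<in> {c..<c + 5} \<and> b \<in> {c..<c + 5})"
        by code_simp+
      show "real (card ?S + 2 * card ?C) <
        \<alpha> * real (count_list ?ds 3) + \<beta> * real (count_list ?ds 2)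
        + \<gamma> * real (count_list ?ds 1)"
        using 1 by (simp add: numeral_eq_Suc)
    qed auto
  next
    case 2
    \<comment> \<open>A single edge: the ring is a cycle of length \<open>2 k\<close>.\<close>
    show ?thesis
    proof (rule ring_family)
      let ?E = "{(0, 1)} :: (nat \<times> nat) set"
      let ?S = "{0} :: nat set" and ?C = "{} :: nat set" and ?ds = "[2, 2] :: nat list"
      show "map (cell_degree 1 ?E) [0..<2] = ?ds"
        by code_simp
      show "\<forall>(a, b)\<in>?E. a < b \<and> b < 2" "{1..<2} \<subseteq> snd ` ?E"
        "\<forall>(a, b)\<in>?E. a \<in> ?S \<or> b \<in> ?S \<or> (\<exists>c\<in>?C. a \<in> {c..<c + 5} \<and> b \<in> {c..<c + 5})"
        by code_simp+
      show "real (card ?S + 2 * card ?C) <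
        \<alpha> * real (count_list ?ds 3) + \<beta> * real (count_list ?ds 2)
        + \<gamma> * real (count_list ?ds 1)"
        using 2 by (simp add: numeral_eq_Suc)
    qed auto
  next
    case 3
    \<comment> \<open>\<open>S\<close> is \<open>{0, 2}\<close>, with leaf \<open>3\<close> at \<open>0\<close> and leaves \<open>4\<close>, \<open>5\<close> at \<open>2\<close>;
          position \<open>1\<close> has all its neighbours in copies of \<open>S\<close>.\<close>
    show ?thesis
    proof (rule ring_family)
      let ?E = "{(0, 1), (1, 2), (0, 3), (2, 4), (2, 5)} :: (nat \<times> nat) set"
      let ?S = "{0, 2} :: nat set" and ?C = "{} :: nat set" and ?ds = "[3, 3, 3, 1, 1, 1] :: nat list"
      show "map (cell_degree 1 ?E) [0..<6] = ?ds"
        by code_simp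
      show "\<forall>(a, b)\<in>?E. a < b \<and> b < 6" "{1..<6} \<subseteq> snd ` ?E"
        "\<forall>(a, b)\<in>?E. a \<in> ?S \<or> b \<in> ?S \<or> (\<exists>c\<in>?C. a \<in> {c..<c + 5} \<and> b \<in> {c..<c + 5})"
        by code_simp+
      show "real (card ?S + 2 * card ?C) <
        \<alpha> * real (count_list ?ds 3) + \<beta> * real (count_list ?ds 2)
        + \<gamma> * real (count_list ?ds 1)"
        using 3 by (simp add: numeral_eq_Suc)
    qed auto
  next
    case 4
    \<comment> \<open>A subdivided cubic multigraph: \<open>S = {0, 3}\<close> are the vertices of degree three, joined by two
          paths through \<open>1\<close> and \<open>2\<close>, and \<open>4\<close> leads from \<open>3\<close> to the next copy.\<close>
    show ?thesis
    proof (rule ring_family)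
      let ?E = "{(0, 1), (0, 2), (1, 3), (2, 3), (3, 4)} :: (nat \<times> nat) set"
      let ?S = "{0, 3} :: nat set" and ?C = "{} :: nat set" and ?ds = "[3, 2, 2, 3, 2] :: nat list"
      show "map (cell_degree 4 ?E) [0..<5] = ?ds"
        by code_simp
      show "\<forall>(a, b)\<in>?E. a < b \<and> b < 5" "{1..<5} \<subseteq> snd ` ?E"
        "\<forall>(a, b)\<in>?E. a \<in> ?S \<or> b \<in> ?S \<or> (\<exists>c\<in>?C. a \<in> {c..<c + 5} \<and> b \<in> {c..<c + 5})"
        by code_simp+
      show "real (card ?S + 2 * card ?C) <
        \<alpha> * real (count_list ?ds 3) + \<beta> * real (count_list ?ds 2)
        + \<gamma> * real (count_list ?ds 1)"
        using 4 by (simp add: numeral_eq_Suc)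
    qed auto
  next
    case 5
    \<comment> \<open>The ring is a cycle with a leaf attached to every second vertex.\<close>
    show ?thesis
    proof (rule ring_family)
      let ?E = "{(0, 1), (0, 2)} :: (nat \<times> nat) set"
      let ?S = "{0} :: nat set" and ?C = "{} :: nat set" and ?ds = "[3, 1, 2] :: nat list"
      show "map (cell_degree 2 ?E) [0..<3] = ?ds"
        by code_simp
      show "\<forall>(a, b)\<in>?E. a < b \<and> b < 3" "{1..<3} \<subseteq> snd ` ?E"
        "\<forall>(a, b)\<in>?E. a \<in> ?S \<or> b \<in> ?S \<or> (\<exists>c\<in>?C. a \<in> {c..<c + 5} \<and> b \<in> {c..<c + 5})"
        by code_simp+
      show "real (card ?S + 2 * card ?C) <
        \<alpha> * real (count_list ?ds 3) + \<beta> * real (count_list ?ds 2)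
        + \<gamma> * real (count_list ?ds 1)"
        using 5 by (simp add: numeral_eq_Suc)
    qed auto
  next
    case 6
    \<comment> \<open>The cell used for \<open>1 < \<alpha> + \<beta> + \<gamma>\<close>, its leaf replaced with a gadget; the vertex of degree two
          is now \<open>1\<close>.\<close>
    show ?thesis
    proof (rule ring_family)
      let ?E = "insert (0, 1) (gadget 0 2) :: (nat \<times> nat) set"
      let ?S = "{0} :: nat set" and ?C = "{2} :: nat set" and ?ds = "[3, 2, 3, 3, 3, 3, 3] :: nat list"
      show "map (cell_degree 1 ?E) [0..<7] = ?ds"
        by code_simp
      show "\<forall>(a, b)\<in>?E. a < b \<and> b < 7" "{1..<7} \<subseteq> snd ` ?E"
        "\<forall>(a, b)\<in>?E. a \<in> ?S \<or> b \<in> ?S \<or> (\<exists>c\<in>?C. a \<in> {c..<c + 5} \<and> b \<in> {c..<c + 5})"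
        by code_simp+
      show "real (card ?S + 2 * card ?C) <
        \<alpha> * real (count_list ?ds 3) + \<beta> * real (count_list ?ds 2)
        + \<gamma> * real (count_list ?ds 1)"
        using 6 by (simp add: numeral_eq_Suc)
    qed auto
  qed
qed

end
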